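(* Let $N$ be a finite supernatural number (a positive integer). Then every derivation in the Bunce-Deddens algebra lifts to the Bunce-Deddens-Toeplitz algebra: for every derivation $\delta:\mathcal B(N)\to B(N)$ there exists a derivation $d:\mathcal A(N)\to A(N)$ such that $[d]=\delta$, where $[d](a+\mathcal K)=d(a)+\mathcal K$ for $a\in\mathcal A(N)$.
   Context: Let $N$ be a positive integer. On $\ell^2(\mathbb Z_{\ge0})$ with canonical basis $\{E_k\}_{k\ge 0}$ let $UE_k=E_{k+1}$ be the unilateral shift, and for a bounded sequence $a(k)$ let $a(\mathbb K)E_k=a(k)E_k$. Let $\mathcal A_{\mathrm{diag,per}}(N)=\{a(\mathbb K): a \text{ is } j\text{-periodic for some } j\mid N\}$. $A(N)$ is the C$^*$-algebra on $\ell^2(\mathbb Z_{\ge0})$ generated by $U$ and $\mathcal A_{\mathrm{diag,per}}(N)$; $\mathcal A(N)$ is the dense $^*$-subalgebra generated algebraically by $U,U^*$ and $\mathcal A_{\mathrm{diag,per}}(N)$. The algebra $\mathcal K$ of compact operators on $\ell^2(\mathbb Z_{\ge0})$ is an ideal in $A(N)$; $B(N)=A(N)/\mathcal K$, and $\mathcal B(N)$ is the image of $\mathcal A(N)$ under the quotient map. A derivation in $A(N)$ (resp. $B(N)$) is a linear map $\mathcal A(N)\to A(N)$ (resp. $\mathcal B(N)\to B(N)$) satisfying the Leibniz rule. Every derivation $d:\mathcal A(N)\to A(N)$ maps $\mathcal A(N)\cap\mathcal K$ into $\mathcal K$, so that $[d]:\mathcal B(N)\to B(N)$, $[d](a+\mathcal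 K)=d(a)+\mathcal K$, is a well-defined derivation. *)

theory Defs
  imports "HOL-Analysis.Analysis"
begin

section \<open>Complex vector spaces and algebras\<close>

class complex_vector = ab_group_add +
  fixes scaleC :: "complex \<Rightarrow> 'a \<Rightarrow> 'a"  (infixr \<open>*\<^sub>C\<close> 75)
  assumes scaleC_add_right: "c *\<^sub>C (x + y) = c *\<^sub>C x + c *\<^sub>C y"
    and scaleC_add_left: "(b + c) *\<^sub>C x = b *\<^sub>C x + c *\<^sub>C x"
    and scaleC_scaleC: "b *\<^sub>C c *\<^sub>C x = (b * c) *\<^sub>C x"
    and scaleC_one: "1 *\<^sub>C x = x"

class complex_algebra = complex_vector + ring +
  assumes mult_scaleC_left: "(c *\<^sub>C x) * y = c *\<^sub>C (x * y)"
    and mult_scaleC_right: "x * (c *\<^sub>C y) = c *\<^sub>C (x * y)"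

definition subalgebra :: "'a::complex_algebra set \<Rightarrow> bool" where
  "subalgebra S \<longleftrightarrow> 0 \<in> S \<and> (\<forall>a\<in>S. \<forall>b\<in>S. a + b \<in> S) \<and> (\<forall>c. \<forall>a\<in>S. c *\<^sub>C a \<in> S) \<and>
     (\<forall>a\<in>S. \<forall>b\<in>S. a * b \<in> S)"

text \<open>A derivation from a subalgebra \<open>S\<close> into \<open>T\<close>; the values outside \<open>S\<close> are irrelevant.\<close>

definition derivation :: "'a::complex_algebra set \<Rightarrow> 'a set \<Rightarrow> ('a \<Rightarrow> 'a) \<Rightarrow> bool" where
  "derivation S T d \<longleftrightarrow> (\<forall>a\<in>S. d a \<in> T) \<and>
     (\<forall>a\<in>S. \<forall>b\<in>S. d (a + b) = d a + d b) \<and>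
     (\<forall>c. \<forall>a\<in>S. d (c *\<^sub>C a) = c *\<^sub>C d a) \<and>
     (\<forall>a\<in>S. \<forall>b\<in>S. d (a * b) = d a * b + a * d b)"


section \<open>The Hilbert space of square-summable sequences\<close>

lemma summable_mult_norm:
  fixes f g :: "nat \<Rightarrow> complex"
  assumes f: "summable (\<lambda>k. (norm (f k))\<^sup>2)" and g: "summable (\<lambda>k. (norm (g k))\<^sup>2)"
  shows "summable (\<lambda>k. norm (f k) * norm (g k))"
proof (rule summable_comparison_test_ev[OF _ summable_add[OF f g]])
  have "norm (norm a * norm b) \<le> (norm a)\<^sup>2 + (norm b)\<^sup>2" for a b :: complex
  proof -
    have "0 \<le> norm a * norm b"
      by simp
    then show ?thesis
      using sum_squares_bound[of "norm a" "norm b"] unfolding real_norm_def abs_mult abs_norm_cancel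
      by linarith
  qed
  then show "\<forall>\<^sub>F k in sequentially. norm (norm (f k) * norm (g k)) \<le> (norm (f k))\<^sup>2 + (norm (g k))\<^sup>2"
    by simp
qed

typedef ell2 = "{x :: nat \<Rightarrow> complex. summable (\<lambda>k. (norm (x k))\<^sup>2)}"
  morphisms coord Abs_ell2
  by (rule exI[of _ "\<lambda>_. 0"]) simp

setup_lifting type_definition_ell2

lemma ell2_summable: "summable (\<lambda>k. (norm (coord x k))\<^sup>2)"
  using coord[of x] by simp

lemma ell2_eqI: "(\<And>k. coord x k = coord y k) \<Longrightarrow> x = y"
  by (simp add: coord_inject[symmetric] fun_eq_iff)

lemma summable_norm_sq_add:
  fixes f g :: "nat \<Rightarrow> complex"
  assumes f: "summable (\<lambda>k. (norm (f k))\<^sup>2)" and g: "summable (\<lambda>k. (norm (g k))\<^sup>2)"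
  shows "summable (\<lambda>k. (norm (f k + g k))\<^sup>2)"
proof (rule summable_comparison_test_ev[OF _ summable_mult[OF summable_add[OF f g], of 2]])
  have "(norm (a + b))\<^sup>2 \<le> 2 * ((norm a)\<^sup>2 + (norm b)\<^sup>2)" for a b :: complex
  proof -
    have "(norm (a + b))\<^sup>2 \<le> (norm a + norm b)\<^sup>2"
      by (intro power_mono norm_triangle_ineq) auto
    also have "\<dots> \<le> 2 * ((norm a)\<^sup>2 + (norm b)\<^sup>2)"
      using sum_squares_bound[of "norm a" "norm b"] by (simp add: power2_sum)
    finally show ?thesis .
  qed
  then show "\<forall>\<^sub>F k in sequentially.
      norm ((norm (f k + g k))\<^sup>2) \<le> 2 * ((norm (f k))\<^sup>2 + (norm (g k))\<^sup>2)"
    by simp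
qed

instantiation ell2 :: complex_vector
begin

lift_definition zero_ell2 :: ell2 is "\<lambda>_. 0"
  by simp

lift_definition plus_ell2 :: "ell2 \<Rightarrow> ell2 \<Rightarrow> ell2" is "\<lambda>x y k. x k + y k"
  by (simp add: summable_norm_sq_add)

lift_definition uminus_ell2 :: "ell2 \<Rightarrow> ell2" is "\<lambda>x k. - x k"
  by simp

lift_definition minus_ell2 :: "ell2 \<Rightarrow> ell2 \<Rightarrow> ell2" is "\<lambda>x y k. x k - y k"
proof -
  fix f g :: "nat \<Rightarrow> complex"
  assume "summable (\<lambda>k. (norm (f k))\<^sup>2)" "summable (\<lambda>k. (norm (g k))\<^sup>2)"
  then show "summable (\<lambda>k. (norm (f k - g k))\<^sup>2)"
    using summable_norm_sq_add[of f "\<lambda>k. - g k"] by simp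
qed

lift_definition scaleC_ell2 :: "complex \<Rightarrow> ell2 \<Rightarrow> ell2" is "\<lambda>c x k. c * x k"
  by (simp add: norm_mult power_mult_distrib summable_mult)

instance
  by standard (transfer; simp add: fun_eq_iff algebra_simps)+

end

lemmas coord_simps [simp] =
  zero_ell2.rep_eq plus_ell2.rep_eq uminus_ell2.rep_eq minus_ell2.rep_eq scaleC_ell2.rep_eq

definition cinner :: "ell2 \<Rightarrow> ell2 \<Rightarrow> complex" where
  "cinner x y = (\<Sum>k. coord x k * cnj (coord y k))"

lemma summable_norm_cinner: "summable (\<lambda>k. norm (coord x k * cnj (coord y k)))"
  using summable_mult_norm[OF ell2_summable[of x] ell2_summable[of y]] by (simp add: norm_mult)

lemma sums_cinner: "(\<lambda>k. coord x k * cnj (coord y k)) sums cinner x y"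
  unfolding cinner_def by (rule summable_sums[OF summable_norm_cancel[OF summable_norm_cinner]])

lemma cinner_add_left: "cinner (x + y) z = cinner x z + cinner y z"
  using sums_unique2[OF sums_cinner[of "x + y" z] sums_cong[THEN iffD1, OF _ sums_add[OF sums_cinner[of x z] sums_cinner[of y z]]]]
  by (simp add: algebra_simps)

lemma cinner_scaleC_left: "cinner (c *\<^sub>C x) y = c * cinner x y"
  using sums_unique2[OF sums_cinner[of "c *\<^sub>C x" y] sums_cong[THEN iffD1, OF _ sums_mult[OF sums_cinner[of x y], of c]]]
  by (simp add: algebra_simps)

lemma cinner_commute: "cinner x y = cnj (cinner y x)"
proof -
  have "(\<lambda>k. cnj (coord y k * cnj (coord x k))) sums cnj (cinner y x)"
    using sums_cinner by (simp only: sums_cnj)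
  then show ?thesis
    using sums_unique2[OF sums_cinner[of x y]] by (simp add: mult.commute)
qed

lemma cinner_add_right: "cinner x (y + z) = cinner x y + cinner x z"
  by (metis cinner_commute cinner_add_left complex_cnj_add)

lemma cinner_scaleC_right: "cinner x (c *\<^sub>C y) = cnj c * cinner x y"
  by (metis cinner_commute cinner_scaleC_left complex_cnj_mult)

instantiation ell2 :: real_inner
begin

definition scaleR_ell2 :: "real \<Rightarrow> ell2 \<Rightarrow> ell2" where
  "scaleR_ell2 r x = complex_of_real r *\<^sub>C x"

definition inner_ell2 :: "ell2 \<Rightarrow> ell2 \<Rightarrow> real" where
  "inner_ell2 x y = Re (cinner x y)"

definition norm_ell2 :: "ell2 \<Rightarrow> real" where
  "norm_ell2 x = sqrt (\<Sum>k. (norm (coord x k))\<^sup>2)"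

definition sgn_ell2 :: "ell2 \<Rightarrow> ell2" where
  "sgn_ell2 x = inverse (norm x) *\<^sub>R x"

definition dist_ell2 :: "ell2 \<Rightarrow> ell2 \<Rightarrow> real" where
  "dist_ell2 x y = norm (x - y)"

definition uniformity_ell2 :: "(ell2 \<times> ell2) filter" where
  "uniformity_ell2 = (INF e\<in>{0<..}. principal {(x, y). dist x y < e})"

definition open_ell2 :: "ell2 set \<Rightarrow> bool" where
  "open_ell2 U \<longleftrightarrow> (\<forall>x\<in>U. eventually (\<lambda>(x', y). x' = x \<longrightarrow> y \<in> U) uniformity)"

instance
proof
  fix x y z :: ell2 and a b r :: real
  show "a *\<^sub>R (x + y) = a *\<^sub>R x + a *\<^sub>R y" "(a + b) *\<^sub>R x = a *\<^sub>R x + b *\<^sub>R x"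
    "a *\<^sub>R b *\<^sub>R x = (a * b) *\<^sub>R x" "1 *\<^sub>R x = x"
    by (simp_all add: scaleR_ell2_def scaleC_add_right scaleC_add_left scaleC_scaleC scaleC_one)
  have sq: "inner x x = (\<Sum>k. (norm (coord x k))\<^sup>2)"
  proof -
    have "(\<lambda>k. Re (coord x k * cnj (coord x k))) sums Re (cinner x x)"
      by (rule sums_Re[OF sums_cinner])
    then show ?thesis
      unfolding inner_ell2_def complex_norm_square[symmetric]
      using sums_unique by fastforce
  qed
  show "inner x y = inner y x"
    unfolding inner_ell2_def by (metis cinner_commute complex_cnj(1) complex.sel(1) complex.collapse)
  show "inner (x + y) z = inner x z + inner y z"
    by (simp add: inner_ell2_def cinner_add_left)
  show "inner (r *\<^sub>R x) y = r * inner x y"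
    by (simp add: inner_ell2_def scaleR_ell2_def cinner_scaleC_left)
  show "0 \<le> inner x x"
    unfolding sq by (intro suminf_nonneg ell2_summable) auto
  show "(inner x x = 0) = (x = 0)"
    unfolding sq using suminf_eq_zero_iff[OF ell2_summable[of x]]
    by (auto intro: ell2_eqI)
  show "norm x = sqrt (inner x x)"
    unfolding sq norm_ell2_def ..
qed (rule sgn_ell2_def dist_ell2_def uniformity_ell2_def open_ell2_def)+

end

lemma ell2_norm_sq: "(norm x)\<^sup>2 = (\<Sum>k. (norm (coord x k))\<^sup>2)"
  unfolding norm_ell2_def by (simp add: suminf_nonneg ell2_summable)

lemma ell2_norm_scaleC [simp]: "norm (c *\<^sub>C x) = norm c * norm (x::ell2)"
proof -
  have "(norm (c *\<^sub>C x))\<^sup>2 = (norm c * norm x)\<^sup>2"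
    unfolding power_mult_distrib ell2_norm_sq
    by (simp add: norm_mult power_mult_distrib suminf_mult ell2_summable)
  then show ?thesis
    by (simp add: power2_eq_iff_nonneg)
qed

lemma norm_cinner_le: "norm (cinner x y) \<le> norm x * norm y"
proof (cases "cinner x y = 0")
  case False
  define c where "c = cnj (sgn (cinner x y))"
  have [simp]: "norm c = 1"
    using False by (simp add: c_def norm_sgn)
  have "c * cinner x y = norm (cinner x y)"
    using False unfolding c_def sgn_eq
    by (simp add: complex_norm_square[symmetric] power2_eq_square mult.commute)
  then have "norm (cinner x y) = inner (c *\<^sub>C x) y"
    by (simp add: inner_ell2_def cinner_scaleC_left)
  also have "\<dots> \<le> norm (c *\<^sub>C x) * norm y"
    by (rule norm_cauchy_schwarz)
  finally show ?thesis
    by simp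
qed simp

lift_definition basis_vec :: "nat \<Rightarrow> ell2" is "\<lambda>k i. if i = k then 1 else 0"
proof -
  fix k :: nat
  have "finite {i. (norm (if i = k then 1 else 0 :: complex))\<^sup>2 \<noteq> 0}"
    by (rule finite_subset[of _ "{k}"]) auto
  then show "summable (\<lambda>i. (norm (if i = k then 1 else 0 :: complex))\<^sup>2)"
    by (intro summable_finite[of "{k}"]) auto
qed


lifting_forget ell2.lifting


section \<open>Bounded operators\<close>

text \<open>The library type of bounded linear functions is only real-linear, so complex linearity is
  imposed separately.\<close>

typedef bop = "{f :: ell2 \<Rightarrow>\<^sub>L ell2. \<forall>c x. blinfun_apply f (c *\<^sub>C x) = c *\<^sub>C blinfun_apply f x}"
  morphisms blinfun_of_bop Abs_bop
  by (rule exI[of _ 0]) (simp add: ell2_eqI)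

setup_lifting type_definition_bop

lift_definition app :: "bop \<Rightarrow> ell2 \<Rightarrow> ell2" is blinfun_apply .

lemma bop_eqI: "(\<And>x. app S x = app T x) \<Longrightarrow> S = T"
  by transfer (rule blinfun_eqI)

lemma app_scaleC: "app T (c *\<^sub>C x) = c *\<^sub>C app T x"
  by transfer simp

lemma bounded_linear_app: "bounded_linear (app T)"
  by transfer (rule blinfun.bounded_linear_right)

text \<open>Only meaningful for bounded complex-linear \<open>f\<close>.\<close>

definition Bop :: "(ell2 \<Rightarrow> ell2) \<Rightarrow> bop" where
  "Bop f = Abs_bop (Blinfun f)"

lemma app_Bop:
  assumes "\<And>x y. f (x + y) = f x + f y" "\<And>c x. f (c *\<^sub>C x) = c *\<^sub>C f x"
    and "\<And>x. norm (f x) \<le> K * norm x"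
  shows "app (Bop f) = f"
proof -
  have "bounded_linear f"
    by (rule bounded_linear_intro[where K = K])
      (simp_all add: assms scaleR_ell2_def mult.commute)
  then show ?thesis
    using assms by (simp add: Bop_def app.rep_eq Abs_bop_inverse bounded_linear_Blinfun_apply)
qed

instantiation bop :: real_normed_vector
begin

lift_definition zero_bop :: bop is 0
  by (simp add: ell2_eqI)

lift_definition plus_bop :: "bop \<Rightarrow> bop \<Rightarrow> bop" is "(+)"
  by (simp add: blinfun.add_left scaleC_add_right)

lift_definition uminus_bop :: "bop \<Rightarrow> bop" is uminus
  by (simp add: blinfun.minus_left ell2_eqI)

lift_definition minus_bop :: "bop \<Rightarrow> bop \<Rightarrow> bop" is "(-)"
  by (auto simp add: blinfun.diff_left algebra_simps intro!: ell2_eqI)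

lift_definition scaleR_bop :: "real \<Rightarrow> bop \<Rightarrow> bop" is "scaleR"
  by (simp add: blinfun.scaleR_left scaleR_ell2_def scaleC_scaleC mult.commute)

lift_definition norm_bop :: "bop \<Rightarrow> real" is norm .

definition sgn_bop :: "bop \<Rightarrow> bop" where
  "sgn_bop x = inverse (norm x) *\<^sub>R x"

definition dist_bop :: "bop \<Rightarrow> bop \<Rightarrow> real" where
  "dist_bop x y = norm (x - y)"

definition uniformity_bop :: "(bop \<times> bop) filter" where
  "uniformity_bop = (INF e\<in>{0<..}. principal {(x, y). dist x y < e})"

definition open_bop :: "bop set \<Rightarrow> bool" where
  "open_bop U \<longleftrightarrow> (\<forall>x\<in>U. eventually (\<lambda>(x', y). x' = x \<longrightarrow> y \<in> U) uniformity)"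

instance
proof
  fix x y z :: bop and a b r :: real
  show "x + y + z = x + (y + z)" "x + y = y + x" "0 + x = x" "- x + x = 0" "x - y = x + - y"
    by (transfer; simp)+
  show "a *\<^sub>R (x + y) = a *\<^sub>R x + a *\<^sub>R y" "(a + b) *\<^sub>R x = a *\<^sub>R x + b *\<^sub>R x"
    "a *\<^sub>R b *\<^sub>R x = (a * b) *\<^sub>R x" "1 *\<^sub>R x = x"
    by (transfer; simp add: algebra_simps)+
  show "(norm x = 0) = (x = 0)" "norm (x + y) \<le> norm x + norm y" "norm (a *\<^sub>R x) = \<bar>a\<bar> * norm x"
    by (transfer; simp add: norm_triangle_ineq)+
qed (rule sgn_bop_def dist_bop_def uniformity_bop_def open_bop_def)+

end

lemma app_plus [simp]: "app (S + T) x = app S x + app T x"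
  by transfer (simp add: blinfun.add_left)

lemma app_minus [simp]: "app (S - T) x = app S x - app T x"
  by transfer (simp add: blinfun.diff_left)

lemma app_zero [simp]: "app 0 x = 0"
  by transfer simp

lemma norm_app_le: "norm (app T x) \<le> norm T * norm x"
  by transfer (rule norm_blinfun)

lemma norm_bop_eq_onorm: "norm T = onorm (app T)"
  by transfer (rule norm_blinfun.rep_eq)

instantiation bop :: real_normed_algebra
begin

lift_definition times_bop :: "bop \<Rightarrow> bop \<Rightarrow> bop" is blinfun_compose
  by simp

instance
proof
  fix x y z :: bop and a :: real
  show "x * y * z = x * (y * z)"
    by transfer (auto intro!: blinfun_eqI)
  show "(x + y) * z = x * z + y * z" "x * (y + z) = x * y + x * z"
    "a *\<^sub>R x * y = a *\<^sub>R (x * y)" "x * a *\<^sub>R y = a *\<^sub>R (x * y)"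
    by (transfer; auto intro!: blinfun_eqI simp: blinfun.bilinear_simps)+
  show "norm (x * y) \<le> norm x * norm y"
    by transfer (rule norm_blinfun_compose)
qed

end

lemma app_times [simp]: "app (S * T) x = app S (app T x)"
  by transfer simp

instantiation bop :: complex_algebra
begin

definition scaleC_bop :: "complex \<Rightarrow> bop \<Rightarrow> bop" where
  "scaleC_bop c T = Bop (\<lambda>x. c *\<^sub>C app T x)"

lemma app_scaleC_bop: "app (c *\<^sub>C T) x = c *\<^sub>C app T x"
proof -
  interpret T: bounded_linear "app T" by (rule bounded_linear_app)
  have "app (Bop (\<lambda>x. c *\<^sub>C app T x)) = (\<lambda>x. c *\<^sub>C app T x)"
  proof (rule app_Bop[where K = "norm c * norm T"])
    show "norm (c *\<^sub>C app T x) \<le> norm c * norm T * norm x" for x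
      using norm_app_le[of T x] by (simp add: mult_left_mono mult.assoc)
  qed (simp_all add: T.add app_scaleC scaleC_add_right scaleC_scaleC mult.commute)
  then show ?thesis
    by (simp add: scaleC_bop_def)
qed

instance
proof
  fix x y :: bop and b c :: complex
  show "c *\<^sub>C (x + y) = c *\<^sub>C x + c *\<^sub>C y" "(b + c) *\<^sub>C x = b *\<^sub>C x + c *\<^sub>C x"
    "b *\<^sub>C c *\<^sub>C x = (b * c) *\<^sub>C x" "1 *\<^sub>C x = x"
    "(c *\<^sub>C x) * y = c *\<^sub>C (x * y)" "x * (c *\<^sub>C y) = c *\<^sub>C (x * y)"
    by (rule bop_eqI; simp add: app_scaleC_bop app_scaleC scaleC_add_right scaleC_add_left
          scaleC_scaleC scaleC_one)+
qed

end

lemma basis_vec_nonzero: "basis_vec k \<noteq> 0"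
  by (metis basis_vec.rep_eq coord_simps(1) zero_neq_one)

instantiation bop :: real_normed_algebra_1
begin

lift_definition one_bop :: bop is id_blinfun
  by simp

lemma app_one [simp]: "app 1 x = x"
  by transfer simp

instance
proof
  fix x :: bop
  show "1 * x = x" "x * 1 = x"
    by (rule bop_eqI; simp)+
  show "(0::bop) \<noteq> 1"
    by (metis app_one app_zero basis_vec_nonzero)
  show "norm (1::bop) = 1"
  proof (rule antisym)
    show "norm (1::bop) \<le> 1"
      by transfer (rule norm_blinfun_id_le)
    show "1 \<le> norm (1::bop)"
      using norm_app_le[of 1 "basis_vec 0"] basis_vec_nonzero[of 0] by simp
  qed
qed

end


lifting_forget bop.lifting

lemma app_add_right: "app T (x + y) = app T x + app T y"
  using bounded_linear_app by (rule bounded_linear.linear[THEN linear_add])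

lemma app_sum_right: "app T (\<Sum>k\<in>A. f k) = (\<Sum>k\<in>A. app T (f k))"
  using bounded_linear_app by (rule bounded_linear.linear[THEN linear_sum])

lemma app_zero_right [simp]: "app T 0 = 0"
  using bounded_linear_app by (rule bounded_linear.linear[THEN linear_0])


subsection \<open>Adjoints\<close>

text \<open>The adjoint exists for every bounded operator, see \<open>cinner_adj_right\<close> below.\<close>

definition adj :: "bop \<Rightarrow> bop" where
  "adj T = (THE S. \<forall>x y. cinner (app T x) y = cinner x (app S y))"

lemma cinner_basis_right: "cinner x (basis_vec k) = coord x k"
proof -
  have "(\<lambda>i. coord x i * cnj (coord (basis_vec k) i)) sums
      (\<Sum>i\<in>{k}. coord x i * cnj (coord (basis_vec k) i))"
    by (rule sums_finite) (auto simp: basis_vec.rep_eq)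
  then show ?thesis
    using sums_unique2[OF sums_cinner] by (fastforce simp: basis_vec.rep_eq)
qed

lemma norm_basis_vec [simp]: "norm (basis_vec k) = 1"
proof -
  have "(norm (basis_vec k))\<^sup>2 = (\<Sum>i\<in>{k}. (norm (coord (basis_vec k) i))\<^sup>2)"
    unfolding ell2_norm_sq by (rule suminf_finite) (auto simp: basis_vec.rep_eq)
  then show ?thesis
    by (simp add: basis_vec.rep_eq power2_eq_1_iff) (smt (verit) norm_ge_zero)
qed

lemma cinner_extend_right: "(\<And>x. cinner x y = cinner x z) \<Longrightarrow> y = z"
  by (metis cinner_basis_right cinner_commute ell2_eqI)

lemma coord_sum: "coord (\<Sum>i\<in>A. f i) k = (\<Sum>i\<in>A. coord (f i) k)"
  by (induction A rule: infinite_finite_induct) auto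

lemma cinner_zero_left [simp]: "cinner 0 y = 0"
  using cinner_add_left[of 0 0 y] by simp

lemma cinner_sum_left: "cinner (\<Sum>i\<in>A. f i) y = (\<Sum>i\<in>A. cinner (f i) y)"
  by (induction A rule: infinite_finite_induct) (auto simp: cinner_add_left)

lemma coord_truncation:
  "coord (\<Sum>k<n. c k *\<^sub>C basis_vec k) i = (if i < n then c i else 0)"
proof -
  have "coord (\<Sum>k<n. c k *\<^sub>C basis_vec k) i = (\<Sum>k<n. if i = k then c k else 0)"
    unfolding coord_sum by (rule sum.cong) (auto simp: basis_vec.rep_eq)
  then show ?thesis
    by simp
qed

lemma norm_truncation: "(norm (\<Sum>k<n. c k *\<^sub>C basis_vec k))\<^sup>2 = (\<Sum>k<n. (norm (c k))\<^sup>2)"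
  unfolding ell2_norm_sq coord_truncation
  by (subst suminf_finite[where N = "{..<n}"]) auto

lemma truncation_tendsto: "(\<lambda>n. \<Sum>k<n. coord x k *\<^sub>C basis_vec k) \<longlonglongrightarrow> x"
proof -
  let ?t = "\<lambda>n. \<Sum>k<n. coord x k *\<^sub>C basis_vec k"
  have *: "(norm (x - ?t n))\<^sup>2 = (norm x)\<^sup>2 - (\<Sum>k<n. (norm (coord x k))\<^sup>2)" for n
  proof -
    have "(\<lambda>k. (norm (coord x k))\<^sup>2 - (if k \<in> {..<n} then (norm (coord x k))\<^sup>2 else 0)) sums
        ((norm x)\<^sup>2 - (\<Sum>k<n. (norm (coord x k))\<^sup>2))"
      unfolding ell2_norm_sq
      by (intro sums_diff summable_sums ell2_summable sums_If_finite_set) auto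
    moreover have "(\<lambda>k. (norm (coord x k))\<^sup>2 - (if k \<in> {..<n} then (norm (coord x k))\<^sup>2 else 0)) =
        (\<lambda>k. (norm (coord (x - ?t n) k))\<^sup>2)"
      by (auto simp: coord_truncation fun_eq_iff)
    ultimately show ?thesis
      unfolding ell2_norm_sq[of "x - ?t n"] by (simp only: sums_iff)
  qed
  have "(\<lambda>n. (norm x)\<^sup>2 - (\<Sum>k<n. (norm (coord x k))\<^sup>2)) \<longlonglongrightarrow> (norm x)\<^sup>2 - (norm x)\<^sup>2"
    by (intro tendsto_intros) (metis ell2_norm_sq ell2_summable summable_LIMSEQ)
  then have "(\<lambda>n. sqrt ((norm (x - ?t n))\<^sup>2)) \<longlonglongrightarrow> sqrt 0"
    unfolding * by (intro tendsto_real_sqrt) simp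
  then have "(\<lambda>n. norm (?t n - x)) \<longlonglongrightarrow> 0"
    by (simp add: norm_minus_commute)
  then show ?thesis
    by (rule LIM_zero_cancel[OF tendsto_norm_zero_cancel])
qed

lemma adj_exists: "\<exists>S. \<forall>x y. cinner (app T x) y = cinner x (app S y)"
proof -
  have "\<exists>z. (\<forall>x. cinner (app T x) y = cinner x z) \<and> norm z \<le> norm T * norm y" for y
  proof -
    define \<phi> where "\<phi> x = cinner (app T x) y" for x
    define c where "c k = cnj (\<phi> (basis_vec k))" for k
    let ?M = "norm T * norm y"
    have bound: "norm (\<phi> x) \<le> ?M * norm x" for x
    proof -
      have "norm (\<phi> x) \<le> norm (app T x) * norm y"
        unfolding \<phi>_def by (rule norm_cinner_le)
      also have "\<dots> \<le> (norm T * norm x) * norm y"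
        by (intro mult_right_mono norm_app_le) auto
      finally show ?thesis
        by (simp add: mult_ac)
    qed
    have \<phi>_sum: "\<phi> (\<Sum>k<n. b k *\<^sub>C basis_vec k) = (\<Sum>k<n. b k * cnj (c k))" for b n
      by (simp add: \<phi>_def c_def app_sum_right cinner_sum_left app_scaleC cinner_scaleC_left)
    have le: "(\<Sum>k<n. (norm (c k))\<^sup>2) \<le> ?M\<^sup>2" for n
    proof -
      let ?v = "\<Sum>k<n. c k *\<^sub>C basis_vec k"
      have "\<phi> ?v = complex_of_real ((norm ?v)\<^sup>2)"
        unfolding \<phi>_sum norm_truncation by (simp only: of_real_sum complex_norm_square)
      then have "(norm ?v)\<^sup>2 \<le> ?M * norm ?v"
        using bound[of ?v] by (simp add: norm_power)
      then have "norm ?v \<le> ?M"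
        by (cases "norm ?v = 0") (auto simp: power2_eq_square)
      then show ?thesis
        unfolding norm_truncation[symmetric] by (intro power_mono) auto
    qed
    have summ: "summable (\<lambda>k. (norm (c k))\<^sup>2)"
      by (rule summableI_nonneg_bounded[OF _ le]) auto
    define z where "z = Abs_ell2 c"
    have z: "coord z = c"
      unfolding z_def using summ by (intro Abs_ell2_inverse) simp
    have "\<phi> x = cinner x z" for x
    proof -
      let ?t = "\<lambda>n. \<Sum>k<n. coord x k *\<^sub>C basis_vec k"
      have "(\<lambda>n. ?M * norm (?t n - x)) \<longlonglongrightarrow> ?M * 0"
        by (intro tendsto_mult tendsto_const tendsto_norm_zero LIM_zero truncation_tendsto)
      then have lim: "(\<lambda>n. ?M * norm (?t n - x)) \<longlonglongrightarrow> 0"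
        by (simp only: mult_zero_right)
      have "norm (\<phi> (?t n) - \<phi> x) \<le> ?M * norm (?t n - x)" for n
      proof -
        have "\<phi> (?t n) = \<phi> (?t n - x) + \<phi> x"
          unfolding \<phi>_def by (metis app_add_right cinner_add_left diff_add_cancel)
        then have "\<phi> (?t n) - \<phi> x = \<phi> (?t n - x)"
          by (simp only: add_diff_cancel_right')
        then show ?thesis
          using bound[of "?t n - x"] by (simp only:)
      qed
      then have "(\<lambda>n. \<phi> (?t n) - \<phi> x) \<longlonglongrightarrow> 0"
        by (intro Lim_null_comparison[OF always_eventually lim] allI)
      then have "(\<lambda>k. coord x k * cnj (coord z k)) sums \<phi> x"
        unfolding sums_def \<phi>_sum z by (rule LIM_zero_cancel)
      then show ?thesis
        using sums_cinner sums_unique2 by blast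
    qed
    moreover have "norm z \<le> ?M"
    proof -
      have "(norm z)\<^sup>2 \<le> ?M\<^sup>2"
        unfolding ell2_norm_sq z by (rule suminf_le_const[OF summ le])
      then show ?thesis
        by (rule power2_le_imp_le) simp
    qed
    ultimately show ?thesis
      unfolding \<phi>_def by blast
  qed
  then obtain f where f: "\<And>x y. cinner (app T x) y = cinner x (f y)"
    and nf: "\<And>y. norm (f y) \<le> norm T * norm y"
    by metis
  have "app (Bop f) = f"
    by (rule app_Bop[OF _ _ nf]; rule cinner_extend_right)
      (simp_all add: f[symmetric] cinner_add_right cinner_scaleC_right)
  then show ?thesis
    using f by metis
qed

lemma cinner_adj_right: "cinner x (app (adj T) y) = cinner (app T x) y"
proof -
  obtain S where S: "\<forall>x y. cinner (app T x) y = cinner x (app S y)"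
    using adj_exists by blast
  have "\<forall>x y. cinner (app T x) y = cinner x (app (adj T) y)"
    unfolding adj_def
    by (rule theI[of _ S]) (use S in \<open>auto intro!: bop_eqI cinner_extend_right\<close>)
  then show ?thesis
    by simp
qed


subsection \<open>Compact operators\<close>

definition compact_op :: "bop \<Rightarrow> bool" where
  "compact_op T \<longleftrightarrow> compact (closure (app T ` cball 0 1))"

lemma compact_opI:
  assumes "compact K" "app T ` cball 0 1 \<subseteq> K"
  shows "compact_op T"
proof -
  have "closure (app T ` cball 0 1) \<subseteq> K"
    using assms by (intro closure_minimal compact_imp_closed)
  then have "K \<inter> closure (app T ` cball 0 1) = closure (app T ` cball 0 1)"
    by blast
  then show ?thesis
    using compact_Int_closed[OF assms(1) closed_closure] unfolding compact_op_def by metis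
qed

lemma compact_op_subset: "app T ` cball 0 1 \<subseteq> closure (app T ` cball 0 1)"
  by (rule closure_subset)

lemma compact_op_zero: "compact_op 0"
  by (rule compact_opI[of "{0}"]) auto

lemma compact_op_add:
  assumes "compact_op S" "compact_op T"
  shows "compact_op (S + T)"
proof (rule compact_opI)
  show "compact {x + y | x y. x \<in> closure (app S ` cball 0 1) \<and> y \<in> closure (app T ` cball 0 1)}"
    using assms unfolding compact_op_def by (rule compact_sums)
  show "app (S + T) ` cball 0 1 \<subseteq>
      {x + y | x y. x \<in> closure (app S ` cball 0 1) \<and> y \<in> closure (app T ` cball 0 1)}"
  proof (rule image_subsetI, rule CollectI, intro exI conjI)
    fix x :: ell2
    assume x: "x \<in> cball 0 1"
    show "app (S + T) x = app S x + app T x"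
      by simp
    show "app S x \<in> closure (app S ` cball 0 1)" "app T x \<in> closure (app T ` cball 0 1)"
      using x compact_op_subset by blast+
  qed
qed

lemma compact_op_mult_left:
  assumes "compact_op T"
  shows "compact_op (S * T)"
proof (rule compact_opI)
  show "compact (app S ` closure (app T ` cball 0 1))"
    using assms unfolding compact_op_def
    by (intro compact_continuous_image linear_continuous_on bounded_linear_app)
  show "app (S * T) ` cball 0 1 \<subseteq> app S ` closure (app T ` cball 0 1)"
    using compact_op_subset[of T] by auto
qed

lemma compact_op_mult_right:
  assumes "compact_op T"
  shows "compact_op (T * S)"
proof (rule compact_opI)
  define r where "r = norm S + 1"
  have r: "r > 0"
    by (simp add: r_def add_nonneg_pos)
  show "compact ((\<lambda>x. r *\<^sub>R x) ` closure (app T ` cball 0 1))"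
    using assms unfolding compact_op_def by (rule compact_scaling)
  show "app (T * S) ` cball 0 1 \<subseteq> (\<lambda>x. r *\<^sub>R x) ` closure (app T ` cball 0 1)"
  proof (rule image_subsetI)
    fix x :: ell2
    assume x: "x \<in> cball 0 1"
    let ?y = "inverse r *\<^sub>R app S x"
    have "norm (app S x) \<le> norm S * norm x"
      by (rule norm_app_le)
    also have "\<dots> \<le> norm S * 1"
      using x by (intro mult_left_mono) auto
    finally have "norm (app S x) \<le> norm S * 1" .
    then have "norm (app S x) \<le> r"
      by (simp add: r_def)
    then have "inverse r * norm (app S x) \<le> inverse r * r"
      using r by (intro mult_left_mono) auto
    then have "?y \<in> cball 0 1"
      using r by simp
    then have "app T ?y \<in> closure (app T ` cball 0 1)"
      using compact_op_subset by blast
    moreover have "app (T * S) x = r *\<^sub>R app T ?y"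
      unfolding linear_scale[OF bounded_linear.linear[OF bounded_linear_app]] using r by simp
    ultimately show "app (T * S) x \<in> (\<lambda>x. r *\<^sub>R x) ` closure (app T ` cball 0 1)"
      by blast
  qed
qed

lemma compact_op_scaleC: "compact_op T \<Longrightarrow> compact_op (c *\<^sub>C T)"
  using compact_op_mult_left[of T "c *\<^sub>C 1"] by (simp add: mult_scaleC_left)

lemma compact_op_minus: "compact_op T \<Longrightarrow> compact_op (- T)"
  using compact_op_mult_left[of T "- 1"] by simp

lemma compact_op_diff: "compact_op S \<Longrightarrow> compact_op T \<Longrightarrow> compact_op (S - T)"
  using compact_op_add[of S "- T"] compact_op_minus by simp

lemma not_compact_op_one: "\<not> compact_op 1"
proof
  assume "compact_op 1"
  then have "seq_compact (cball (0::ell2) 1)"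
    by (simp add: compact_op_def compact_eq_seq_compact_metric)
  moreover have "\<forall>k. basis_vec k \<in> cball 0 1"
    by simp
  ultimately obtain l r where r: "strict_mono r" and l: "(basis_vec \<circ> r) \<longlonglongrightarrow> l"
    unfolding seq_compact_def by metis
  have "Cauchy (basis_vec \<circ> r)"
    using l by (rule LIMSEQ_imp_Cauchy)
  then obtain M where M: "\<And>m n. m \<ge> M \<Longrightarrow> n \<ge> M \<Longrightarrow> dist (basis_vec (r m)) (basis_vec (r n)) < 1"
    unfolding Cauchy_def by (metis comp_apply zero_less_one)
  let ?x = "basis_vec (r M)" and ?y = "basis_vec (r (Suc M))"
  have "r M \<noteq> r (Suc M)"
    using strict_monoD[OF r, of M "Suc M"] by simp
  then have "cinner (?x - ?y) ?x = 1"
    by (simp add: cinner_basis_right basis_vec.rep_eq)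
  then have "1 \<le> norm (?x - ?y) * norm ?x"
    using norm_cinner_le[of "?x - ?y" ?x] by simp
  then show False
    using M[of M "Suc M"] by (simp add: dist_norm)
qed


section \<open>The Calkin algebra\<close>

quotient_type calkin = bop / "\<lambda>S T. compact_op (S - T)"
  morphisms rep_calkin to_calkin
proof (rule equivpI)
  show "reflp (\<lambda>S T. compact_op (S - T))"
    by (simp add: reflp_def compact_op_zero)
  show "symp (\<lambda>S T. compact_op (S - T))"
    by (metis (no_types, lifting) sympI compact_op_minus minus_diff_eq)
  show "transp (\<lambda>S T. compact_op (S - T))"
    by (rule transpI) (metis compact_op_add diff_add_cancel add_diff_eq)
qed

lemma to_calkin_eq_iff: "to_calkin S = to_calkin T \<longleftrightarrow> compact_op (S - T)"
  by (rule calkin.abs_eq_iff)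

instantiation calkin :: "{complex_algebra, ring_1}"
begin

lift_definition zero_calkin :: calkin is 0 .

lift_definition one_calkin :: calkin is 1 .

lift_definition plus_calkin :: "calkin \<Rightarrow> calkin \<Rightarrow> calkin" is "(+)"
  by (metis add_diff_add compact_op_add)

lift_definition uminus_calkin :: "calkin \<Rightarrow> calkin" is uminus
  by (metis compact_op_minus minus_diff_minus)

lift_definition minus_calkin :: "calkin \<Rightarrow> calkin \<Rightarrow> calkin" is "(-)"
proof -
  fix a b c d :: bop
  assume "compact_op (a - b)" "compact_op (c - d)"
  then have "compact_op ((a - b) - (c - d))"
    by (rule compact_op_diff)
  then show "compact_op (a - c - (b - d))"
    by (simp add: algebra_simps)
qed

lift_definition times_calkin :: "calkin \<Rightarrow> calkin \<Rightarrow> calkin" is "(*)"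
proof -
  fix a b c d :: bop
  assume "compact_op (a - b)" "compact_op (c - d)"
  then have "compact_op ((a - b) * c + b * (c - d))"
    by (intro compact_op_add compact_op_mult_left compact_op_mult_right)
  then show "compact_op (a * c - b * d)"
    by (simp add: algebra_simps)
qed

lift_definition scaleC_calkin :: "complex \<Rightarrow> calkin \<Rightarrow> calkin" is scaleC
proof -
  fix c :: complex and a b :: bop
  assume "compact_op (a - b)"
  then have "compact_op (c *\<^sub>C (a - b))"
    by (rule compact_op_scaleC)
  moreover have "c *\<^sub>C (a - b) = c *\<^sub>C a - c *\<^sub>C b"
    by (metis add_diff_cancel diff_add_cancel scaleC_add_right)
  ultimately show "compact_op (c *\<^sub>C a - c *\<^sub>C b)"
    by simp
qed

instance
proof
  fix x y z :: calkin and b c :: complex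
  show "x + y + z = x + (y + z)" "x + y = y + x" "0 + x = x" "- x + x = 0" "x - y = x + - y"
    "x * y * z = x * (y * z)" "(x + y) * z = x * z + y * z" "x * (y + z) = x * y + x * z"
    "1 * x = x" "x * 1 = x"
    by (transfer; simp add: algebra_simps compact_op_zero)+
  show "c *\<^sub>C (x + y) = c *\<^sub>C x + c *\<^sub>C y" "(b + c) *\<^sub>C x = b *\<^sub>C x + c *\<^sub>C x"
    "b *\<^sub>C c *\<^sub>C x = (b * c) *\<^sub>C x" "1 *\<^sub>C x = x"
    "(c *\<^sub>C x) * y = c *\<^sub>C (x * y)" "x * (c *\<^sub>C y) = c *\<^sub>C (x * y)"
    by (transfer; simp add: scaleC_add_right scaleC_add_left scaleC_scaleC scaleC_one
          mult_scaleC_left mult_scaleC_right compact_op_zero)+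
  show "(0::calkin) \<noteq> 1"
    by transfer (metis not_compact_op_one compact_op_minus diff_0 minus_minus)
qed

end


section \<open>Bunce-Deddens-Toeplitz and Bunce-Deddens algebras\<close>

definition shift :: bop where
  "shift = Bop (\<lambda>x. Abs_ell2 (\<lambda>k. case k of 0 \<Rightarrow> 0 | Suc i \<Rightarrow> coord x i))"

text \<open>Only meaningful for bounded \<open>a\<close>, see \<open>coord_diag_op\<close> below.\<close>

definition diag_op :: "(nat \<Rightarrow> complex) \<Rightarrow> bop" where
  "diag_op a = Bop (\<lambda>x. Abs_ell2 (\<lambda>k. a k * coord x k))"

lemma coord_shift: "coord (app shift x) k = (case k of 0 \<Rightarrow> 0 | Suc i \<Rightarrow> coord x i)"
proof -
  define f where "f x = Abs_ell2 (\<lambda>k. case k of 0 \<Rightarrow> 0 | Suc i \<Rightarrow> coord x i)" for x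
  have sums: "(\<lambda>k. (norm (case k of 0 \<Rightarrow> 0 | Suc i \<Rightarrow> coord x i))\<^sup>2) sums (norm x)\<^sup>2" for x
    using sums_Suc[of "\<lambda>k. (norm (case k of 0 \<Rightarrow> 0 | Suc i \<Rightarrow> coord x i))\<^sup>2", simplified,
        OF summable_sums[OF ell2_summable[of x]]]
    by (simp add: ell2_norm_sq)
  have f: "coord (f x) = (\<lambda>k. case k of 0 \<Rightarrow> 0 | Suc i \<Rightarrow> coord x i)" for x
    unfolding f_def using sums_summable[OF sums[of x]] by (intro Abs_ell2_inverse) simp
  have "app (Bop f) = f"
  proof (rule app_Bop[where K = 1])
    show "norm (f x) \<le> 1 * norm x" for x
    proof -
      have "(norm (f x))\<^sup>2 = (norm x)\<^sup>2"
        using sums_unique[OF sums[of x]] by (simp add: ell2_norm_sq[of "f x"] f)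
      then show ?thesis
        by simp
    qed
  qed (auto intro!: ell2_eqI simp: f split: nat.split)
  moreover have "shift = Bop f"
    by (simp add: shift_def f_def[abs_def])
  ultimately show ?thesis
    by (simp add: f)
qed

lemma coord_diag_op:
  assumes "bounded (range a)"
  shows "coord (app (diag_op a) x) k = a k * coord x k"
proof -
  define f where "f x = Abs_ell2 (\<lambda>k. a k * coord x k)" for x
  obtain K where K: "K > 0" "\<And>k. norm (a k) \<le> K"
    using assms unfolding bounded_pos by auto
  have le: "(norm (a k * coord x k))\<^sup>2 \<le> K\<^sup>2 * (norm (coord x k))\<^sup>2" for x k
    unfolding norm_mult power_mult_distrib using K by (intro mult_right_mono power_mono) auto
  have summ: "summable (\<lambda>k. K\<^sup>2 * (norm (coord x k))\<^sup>2)" for x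
    by (intro summable_mult ell2_summable)
  have summ': "summable (\<lambda>k. (norm (a k * coord x k))\<^sup>2)" for x
    by (rule summable_comparison_test_ev[OF _ summ[of x]]) (use le in auto)
  have f: "coord (f x) = (\<lambda>k. a k * coord x k)" for x
    unfolding f_def using summ' by (intro Abs_ell2_inverse) simp
  have "app (Bop f) = f"
  proof (rule app_Bop[where K = K])
    show "norm (f x) \<le> K * norm x" for x
    proof -
      have "(norm (f x))\<^sup>2 \<le> (\<Sum>k. K\<^sup>2 * (norm (coord x k))\<^sup>2)"
        unfolding ell2_norm_sq f by (rule suminf_le[OF le summ' summ])
      also have "\<dots> = (K * norm x)\<^sup>2"
        by (simp add: suminf_mult ell2_summable ell2_norm_sq power_mult_distrib)
      finally show ?thesis
        by (rule power2_le_imp_le) (use K in simp)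
    qed
  qed (auto intro!: ell2_eqI simp: f algebra_simps)
  moreover have "diag_op a = Bop f"
    by (simp add: diag_op_def f_def[abs_def])
  ultimately show ?thesis
    by (simp add: f)
qed

lemma app_shift_basis_vec: "app shift (basis_vec k) = basis_vec (Suc k)"
  by (rule ell2_eqI) (simp add: coord_shift basis_vec.rep_eq split: nat.split)

lemma app_diag_op_basis_vec:
  "bounded (range a) \<Longrightarrow> app (diag_op a) (basis_vec k) = a k *\<^sub>C basis_vec k"
  by (rule ell2_eqI) (simp add: coord_diag_op basis_vec.rep_eq)

definition star_subalgebra :: "bop set \<Rightarrow> bool" where
  "star_subalgebra S \<longleftrightarrow> subalgebra S \<and> (\<forall>a\<in>S. adj a \<in> S)"

definition cstar_subalgebra :: "bop set \<Rightarrow> bool" where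
  "cstar_subalgebra S \<longleftrightarrow> star_subalgebra S \<and> closed S"

definition periodic :: "nat \<Rightarrow> (nat \<Rightarrow> complex) \<Rightarrow> bool" where
  "periodic j a \<longleftrightarrow> (\<forall>k. a (k + j) = a k)"

definition diag_per :: "nat \<Rightarrow> bop set" where
  "diag_per N = {diag_op a | a. bounded (range a) \<and> (\<exists>j. j dvd N \<and> periodic j a)}"

text \<open>The Bunce-Deddens-Toeplitz algebra \<open>A(N)\<close> and its dense subalgebra of polynomials in
  \<open>U\<close>, \<open>U\<^sup>*\<close> and periodic diagonal operators.\<close>

definition BDT :: "nat \<Rightarrow> bop set" where
  "BDT N = cstar_subalgebra hull (insert shift (diag_per N))"

definition BDT_poly :: "nat \<Rightarrow> bop set" where
  "BDT_poly N = subalgebra hull ({shift, adj shift} \<union> diag_per N)"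

text \<open>The Bunce-Deddens algebra \<open>B(N) = A(N)/\<K>\<close>, realised inside the Calkin algebra: since
  \<open>A(N)\<close> contains the ideal \<open>\<K>\<close> of compact operators, the coset \<open>a + \<K>\<close> in \<open>A(N)\<close> is the class
  \<open>to_calkin a\<close>.\<close>

definition BD :: "nat \<Rightarrow> calkin set" where
  "BD N = to_calkin ` BDT N"

definition BD_poly :: "nat \<Rightarrow> calkin set" where
  "BD_poly N = to_calkin ` BDT_poly N"

end

(* Let p_i be the diagonal projection onto the indices congruent to i mod N. With
   b = sum_i delta(p_i) p_i the derivation delta - [b, .] vanishes on the periodic diagonal operators,
   and b lifts to A(N). For a derivation delta that vanishes on diagonals, delta(u) = u f where f
   commutes with the diagonals; averaging over the p_i gives a lift F of f that still commutes with
   them. Define an unbounded operator H on finitely supported vectors by H E_0 = 0 and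
   H E_{k+1} = U (H + F) E_k. Then [H, U] = U F, [H, U^* ] = - F U^* and [H, a] = 0 for periodic
   diagonal a, all of which lie in A(N), so [H, .] is a lift of delta. *)

theory Submission
  imports Defs
begin

section \<open>Subalgebras and derivations\<close>

lemma subalgebra_zero: "subalgebra S \<Longrightarrow> 0 \<in> S"
  and subalgebra_add: "subalgebra S \<Longrightarrow> a \<in> S \<Longrightarrow> b \<in> S \<Longrightarrow> a + b \<in> S"
  and subalgebra_scaleC: "subalgebra S \<Longrightarrow> a \<in> S \<Longrightarrow> c *\<^sub>C a \<in> S"
  and subalgebra_mult: "subalgebra S \<Longrightarrow> a \<in> S \<Longrightarrow> b \<in> S \<Longrightarrow> a * b \<in> S"
  unfolding subalgebra_def by blast+

lemma scaleC_zero_left [simp]: "0 *\<^sub>C (x::'a::complex_vector) = 0"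
  using scaleC_add_left[of 0 0 x] by simp

lemma scaleC_minus_left: "(- c) *\<^sub>C (x::'a::complex_vector) = - (c *\<^sub>C x)"
  using scaleC_add_left[of "- c" c x] by (simp add: eq_neg_iff_add_eq_0)

lemma scaleC_zero_right [simp]: "c *\<^sub>C (0::'a::complex_vector) = 0"
  using scaleC_add_right[of c 0 "0::'a"] by simp

lemma scaleC_minus_right: "c *\<^sub>C (- x::'a::complex_vector) = - (c *\<^sub>C x)"
  using scaleC_add_right[of c "- x" x] by (simp add: eq_neg_iff_add_eq_0)

lemma scaleC_diff_right: "c *\<^sub>C (x - y::'a::complex_vector) = c *\<^sub>C x - c *\<^sub>C y"
  using scaleC_add_right[of c x "- y"] by (simp add: scaleC_minus_right)

lemma subalgebra_uminus: "subalgebra S \<Longrightarrow> a \<in> S \<Longrightarrow> - a \<in> S"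
  using subalgebra_scaleC[of S a "- 1"] by (simp add: scaleC_minus_left scaleC_one)

lemma subalgebra_diff: "subalgebra S \<Longrightarrow> a \<in> S \<Longrightarrow> b \<in> S \<Longrightarrow> a - b \<in> S"
  using subalgebra_add[of S a "- b"] by (simp add: subalgebra_uminus)

lemma subalgebra_sum: "subalgebra S \<Longrightarrow> (\<And>i. i \<in> I \<Longrightarrow> f i \<in> S) \<Longrightarrow> sum f I \<in> S"
  by (induction I rule: infinite_finite_induct) (auto simp: subalgebra_zero subalgebra_add)

lemma subalgebra_hull: "subalgebra (subalgebra hull S)"
  by (rule hull_in) (simp add: subalgebra_def Ball_def)

section \<open>Derivations and their inner parts\<close>

lemma derivation_in: "derivation S T d \<Longrightarrow> a \<in> S \<Longrightarrow> d a \<in> T"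
  and derivation_add: "derivation S T d \<Longrightarrow> a \<in> S \<Longrightarrow> b \<in> S \<Longrightarrow> d (a + b) = d a + d b"
  and derivation_scaleC: "derivation S T d \<Longrightarrow> a \<in> S \<Longrightarrow> d (c *\<^sub>C a) = c *\<^sub>C d a"
  and derivation_mult: "derivation S T d \<Longrightarrow> a \<in> S \<Longrightarrow> b \<in> S \<Longrightarrow> d (a * b) = d a * b + a * d b"
  unfolding derivation_def by blast+

lemma derivation_zero: "derivation S T d \<Longrightarrow> 0 \<in> S \<Longrightarrow> d 0 = 0"
  using derivation_scaleC[of S T d 0 0] by simp

lemma derivation_sum:
  assumes "derivation S T d" "subalgebra S" "\<And>i. i \<in> I \<Longrightarrow> f i \<in> S"
  shows "d (sum f I) = (\<Sum>i\<in>I. d (f i))"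
  using assms(3)
  by (induction I rule: infinite_finite_induct)
    (simp_all add: derivation_zero[OF assms(1)] subalgebra_zero[OF assms(2)]
      derivation_add[OF assms(1)] subalgebra_sum[OF assms(2)])

text \<open>The commutator with \<open>b\<close> is itself a derivation. It is needed twice: in the
  quotient to subtract an inner part, and in \<open>BDT N\<close> to add its lift back.\<close>

lemma derivation_add_commutator:
  assumes d: "derivation S T d" and T: "subalgebra T" and "S \<subseteq> T" and "b \<in> T"
  shows "derivation S T (\<lambda>x. d x + (b * x - x * b))"
  unfolding derivation_def
proof (intro conjI ballI allI)
  fix x y c assume x: "x \<in> S" and y: "y \<in> S"
  show "d x + (b * x - x * b) \<in> T"
    using assms x by (blast intro: subalgebra_add subalgebra_diff subalgebra_mult derivation_in)
  show "d (x + y) + (b * (x + y) - (x + y) * b) = d x + (b * x - x * b) + (d y + (b * y - y * b))"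
    using derivation_add[OF d x y] by (simp add: algebra_simps)
  show "d (x * y) + (b * (x * y) - x * y * b) =
      (d x + (b * x - x * b)) * y + x * (d y + (b * y - y * b))"
    using derivation_mult[OF d x y] by (simp add: algebra_simps)
  show "d (c *\<^sub>C x) + (b * (c *\<^sub>C x) - (c *\<^sub>C x) * b) = c *\<^sub>C (d x + (b * x - x * b))"
    using derivation_scaleC[OF d x]
    by (simp add: mult_scaleC_left mult_scaleC_right scaleC_add_right scaleC_diff_right)
qed

text \<open>The Leibniz rule for the product of \<open>p j\<close> and \<open>p i\<close> trades
  \<open>p j * d (p i)\<close> for \<open>d (p j * p i) - d (p j) * p i\<close>. Multiplying by
  \<open>p i\<close> on the right and summing, the first terms leave only \<open>i = j\<close>, and
  the second ones collapse because the idempotents sum to 1.\<close>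

lemma derivation_inner_on_idempotents:
  fixes p :: "'i \<Rightarrow> 'a::{complex_algebra, ring_1}"
  assumes d: "derivation S T d" and S: "subalgebra S" and fin: "finite I"
    and p: "\<And>i. i \<in> I \<Longrightarrow> p i \<in> S"
    and orth: "\<And>i j. i \<in> I \<Longrightarrow> j \<in> I \<Longrightarrow> p i * p j = (if i = j then p i else 0)"
    and one: "(\<Sum>i\<in>I. p i) = 1" and j: "j \<in> I"
  defines "b \<equiv> \<Sum>i\<in>I. d (p i) * p i"
  shows "d (p j) = b * p j - p j * b"
proof -
  have "b * p j = (\<Sum>i\<in>I. d (p i) * (p i * p j))"
    by (simp add: b_def sum_distrib_right mult.assoc)
  also have "\<dots> = (\<Sum>i\<in>I. if i = j then d (p j) * p j else 0)"
    by (rule sum.cong) (auto simp: orth j)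
  also have "\<dots> = d (p j) * p j"
    using fin j by simp
  finally have 1: "b * p j = d (p j) * p j" .
  have "p j * b = (\<Sum>i\<in>I. p j * d (p i) * p i)"
    by (simp add: b_def sum_distrib_left mult.assoc)
  also have "\<dots> = (\<Sum>i\<in>I. (if i = j then d (p j) * p j else 0) - d (p j) * p i)"
  proof (rule sum.cong)
    fix i assume i: "i \<in> I"
    have "p j * d (p i) = d (p j * p i) - d (p j) * p i"
      using derivation_mult[OF d p[OF j] p[OF i]] by simp
    then have "p j * d (p i) * p i = d (p j * p i) * p i - d (p j) * (p i * p i)"
      by (simp only: left_diff_distrib mult.assoc)
    then show "p j * d (p i) * p i = (if i = j then d (p j) * p j else 0) - d (p j) * p i"
      using i j derivation_zero[OF d subalgebra_zero[OF S]] by (auto simp: orth)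
  qed simp
  also have "\<dots> = d (p j) * p j - d (p j)"
    using fin j by (simp add: sum_subtractf sum_distrib_left[symmetric] one)
  finally show ?thesis
    using 1 by simp
qed


section \<open>Operators on finitely supported vectors\<close>

text \<open>Truncations of a vector converge to it in norm, and bounded operators are
  continuous.\<close>

lemma bop_eqI_basis:
  assumes "\<And>k. app S (basis_vec k) = app T (basis_vec k)"
  shows "S = T"
proof (rule bop_eqI)
  fix x
  have lim: "(\<lambda>n. app R (\<Sum>k<n. coord x k *\<^sub>C basis_vec k)) \<longlonglongrightarrow> app R x" for R
    by (rule bounded_linear.tendsto[OF bounded_linear_app truncation_tendsto])
  have "app S (\<Sum>k<n. coord x k *\<^sub>C basis_vec k) = app T (\<Sum>k<n. coord x k *\<^sub>C basis_vec k)" for n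
    by (simp add: app_sum_right app_scaleC assms)
  then show "app S x = app T x"
    using lim[of S] lim[of T] LIMSEQ_unique by simp
qed

section \<open>Possibly unbounded linear maps on finitely supported vectors\<close>

definition fin_supp :: "ell2 set" where
  "fin_supp = {x. finite {k. coord x k \<noteq> 0}}"

text \<open>The linear map sending the basis vector with index \<open>k\<close> to
  \<open>h k\<close>. No growth condition is put on \<open>h\<close>, so the map need not be
  bounded. On infinite support the sum takes the default value 0, so only arguments in
  \<open>fin_supp\<close> matter.\<close>

definition fin_ext :: "(nat \<Rightarrow> ell2) \<Rightarrow> ell2 \<Rightarrow> ell2" where
  "fin_ext h x = (\<Sum>k | coord x k \<noteq> 0. coord x k *\<^sub>C h k)"

lemma fin_ext_superset:
  "finite A \<Longrightarrow> {k. coord x k \<noteq> 0} \<subseteq> A \<Longrightarrow> fin_ext h x = (\<Sum>k\<in>A. coord x k *\<^sub>C h k)"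
  unfolding fin_ext_def by (rule sum.mono_neutral_left) auto

lemma fin_supp_zero: "0 \<in> fin_supp"
  by (simp add: fin_supp_def)

lemma fin_supp_basis_vec: "basis_vec k \<in> fin_supp"
  by (simp add: fin_supp_def basis_vec.rep_eq)

lemma fin_supp_add: "x \<in> fin_supp \<Longrightarrow> y \<in> fin_supp \<Longrightarrow> x + y \<in> fin_supp"
  unfolding fin_supp_def mem_Collect_eq
  by (rule finite_subset[of _ "{k. coord x k \<noteq> 0} \<union> {k. coord y k \<noteq> 0}"]) auto

lemma fin_supp_scaleC: "x \<in> fin_supp \<Longrightarrow> c *\<^sub>C x \<in> fin_supp"
  unfolding fin_supp_def mem_Collect_eq
  by (rule finite_subset[of _ "{k. coord x k \<noteq> 0}"]) auto

lemma fin_ext_zero: "fin_ext h 0 = 0"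
  by (simp add: fin_ext_def)

lemma fin_ext_basis_vec: "fin_ext h (basis_vec k) = h k"
  by (subst fin_ext_superset[of "{k}"]) (auto simp: basis_vec.rep_eq scaleC_one)

lemma fin_ext_add:
  assumes "x \<in> fin_supp" "y \<in> fin_supp"
  shows "fin_ext h (x + y) = fin_ext h x + fin_ext h y"
proof -
  let ?A = "{k. coord x k \<noteq> 0} \<union> {k. coord y k \<noteq> 0}"
  have A: "finite ?A"
    using assms by (simp add: fin_supp_def)
  have "fin_ext h z = (\<Sum>k\<in>?A. coord z k *\<^sub>C h k)" if "z \<in> {x, y, x + y}" for z
    using that by (intro fin_ext_superset A) auto
  then show ?thesis
    by (simp add: scaleC_add_left sum.distrib)
qed

lemma fin_ext_scaleC:
  assumes "x \<in> fin_supp"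
  shows "fin_ext h (c *\<^sub>C x) = c *\<^sub>C fin_ext h x"
proof -
  let ?A = "{k. coord x k \<noteq> 0}"
  have A: "finite ?A"
    using assms by (simp add: fin_supp_def)
  have scale: "c *\<^sub>C (\<Sum>k\<in>?A. f k) = (\<Sum>k\<in>?A. c *\<^sub>C f k)" for f :: "nat \<Rightarrow> ell2"
    by (induction rule: finite_induct[OF A]) (simp_all add: scaleC_add_right)
  have "fin_ext h z = (\<Sum>k\<in>?A. coord z k *\<^sub>C h k)" if "z \<in> {x, c *\<^sub>C x}" for z
    using that by (intro fin_ext_superset A) auto
  then show ?thesis
    by (simp add: scale scaleC_scaleC)
qed

text \<open>A finitely supported vector equals one of its own truncations, which is a finite linear
  combination of basis vectors.\<close>

lemma fin_supp_induct [consumes 1, case_names zero basis_vec add scaleC]: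
  assumes x: "x \<in> fin_supp" and zero: "P 0" and basis: "\<And>k. P (basis_vec k)"
    and add: "\<And>x y. x \<in> fin_supp \<Longrightarrow> y \<in> fin_supp \<Longrightarrow> P x \<Longrightarrow> P y \<Longrightarrow> P (x + y)"
    and scale: "\<And>c x. x \<in> fin_supp \<Longrightarrow> P x \<Longrightarrow> P (c *\<^sub>C x)"
  shows "P x"
proof -
  have *: "(\<Sum>k<n. coord x k *\<^sub>C basis_vec k) \<in> fin_supp \<and> P (\<Sum>k<n. coord x k *\<^sub>C basis_vec k)" for n
    by (induction n)
      (simp_all add: fin_supp_zero zero fin_supp_add fin_supp_scaleC fin_supp_basis_vec add scale basis)
  obtain n where n: "{k. coord x k \<noteq> 0} \<subseteq> {..<n}"
    using x finite_nat_iff_bounded unfolding fin_supp_def by blast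
  have "(\<Sum>k<n. coord x k *\<^sub>C basis_vec k) = x"
    by (rule ell2_eqI) (use n in \<open>auto simp: coord_truncation\<close>)
  then show ?thesis
    using *[of n] by simp
qed

text \<open>With H the map \<open>fin_ext h\<close>, this says that [H, T] is the restriction of the
  bounded operator \<open>R\<close>. It is a relation because [H, T] need not be bounded for every
  \<open>T\<close>. The vectors \<open>h k\<close> may have infinite support; only \<open>T\<close>
  has to preserve \<open>fin_supp\<close>, since H is never applied to its own values.\<close>

definition fin_commutator :: "(nat \<Rightarrow> ell2) \<Rightarrow> bop \<Rightarrow> bop \<Rightarrow> bool" where
  "fin_commutator h T R \<longleftrightarrow> (\<forall>x\<in>fin_supp. app T x \<in> fin_supp \<and>
     app R x = fin_ext h (app T x) - app T (fin_ext h x))"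

lemma app_diff_right: "app T (x - y) = app T x - app T y"
  using bounded_linear_app by (rule bounded_linear.linear[THEN linear_diff])

lemma fin_commutatorI:
  assumes fin: "\<And>k. app T (basis_vec k) \<in> fin_supp"
    and eq: "\<And>k. app R (basis_vec k) = fin_ext h (app T (basis_vec k)) - app T (h k)"
  shows "fin_commutator h T R"
  unfolding fin_commutator_def
proof
  fix x assume "x \<in> fin_supp"
  then show "app T x \<in> fin_supp \<and> app R x = fin_ext h (app T x) - app T (fin_ext h x)"
    by (induction x rule: fin_supp_induct)
      (simp_all add: fin eq fin_supp_zero fin_ext_zero fin_ext_basis_vec app_add_right fin_supp_add
        fin_ext_add app_scaleC fin_supp_scaleC fin_ext_scaleC scaleC_diff_right)
qed

text \<open>This turns the relation into a partial function of \<open>T\<close>, from which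
  linearity and the Leibniz rule of the lift follow.\<close>

lemma fin_commutator_unique: "fin_commutator h T R \<Longrightarrow> fin_commutator h T R' \<Longrightarrow> R = R'"
  by (rule bop_eqI_basis) (simp add: fin_commutator_def fin_supp_basis_vec)

lemma fin_commutator_zero: "fin_commutator h 0 0"
  by (simp add: fin_commutator_def fin_supp_zero fin_ext_zero)

lemma fin_commutator_add:
  "fin_commutator h S Q \<Longrightarrow> fin_commutator h T R \<Longrightarrow> fin_commutator h (S + T) (Q + R)"
  by (simp add: fin_commutator_def fin_supp_add fin_ext_add)

lemma fin_commutator_scaleC:
  "fin_commutator h T R \<Longrightarrow> fin_commutator h (c *\<^sub>C T) (c *\<^sub>C R)"
  by (simp add: fin_commutator_def app_scaleC_bop fin_supp_scaleC fin_ext_scaleC scaleC_diff_right)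

text \<open>Insert S H T x between H S T x and S T H x; the formula for \<open>S\<close> applies to
  \<open>app T x\<close> because that vector is again finitely supported.\<close>

lemma fin_commutator_mult:
  "fin_commutator h S Q \<Longrightarrow> fin_commutator h T R \<Longrightarrow> fin_commutator h (S * T) (Q * T + S * R)"
  by (simp add: fin_commutator_def app_diff_right)


section \<open>Bunce-Deddens-Toeplitz and Bunce-Deddens algebras as subalgebras\<close>

lemma star_subalgebra_Inter: "(\<And>S. S \<in> \<S> \<Longrightarrow> star_subalgebra S) \<Longrightarrow> star_subalgebra (\<Inter>\<S>)"
  by (simp add: star_subalgebra_def subalgebra_def)

lemma cstar_subalgebra_BDT: "cstar_subalgebra (BDT N)"
  unfolding BDT_def
  by (rule hull_in) (auto simp: cstar_subalgebra_def intro!: star_subalgebra_Inter)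

lemma subalgebra_BDT: "subalgebra (BDT N)"
  using cstar_subalgebra_BDT by (simp add: cstar_subalgebra_def star_subalgebra_def)

lemma subalgebra_BDT_poly: "subalgebra (BDT_poly N)"
  unfolding BDT_poly_def by (rule subalgebra_hull)

lemma shift_in_BDT_poly: "shift \<in> BDT_poly N"
  and adj_shift_in_BDT_poly: "adj shift \<in> BDT_poly N"
  and diag_per_subset_BDT_poly: "diag_per N \<subseteq> BDT_poly N"
  using hull_subset[of "{shift, adj shift} \<union> diag_per N" subalgebra] by (auto simp: BDT_poly_def)

text \<open>The adjoint of the shift is not among the generators of \<open>BDT N\<close>, but
  closure under adjoints supplies it.\<close>

lemma BDT_poly_subset_BDT: "BDT_poly N \<subseteq> BDT N"
proof -
  have "insert shift (diag_per N) \<subseteq> BDT N"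
    unfolding BDT_def by (rule hull_subset)
  moreover from this have "adj shift \<in> BDT N"
    using cstar_subalgebra_BDT by (auto simp: cstar_subalgebra_def star_subalgebra_def)
  ultimately show ?thesis
    unfolding BDT_poly_def by (intro hull_minimal subalgebra_BDT) auto
qed

lemma to_calkin_mult: "to_calkin (S * T) = to_calkin S * to_calkin T"
  and to_calkin_add: "to_calkin (S + T) = to_calkin S + to_calkin T"
  and to_calkin_diff: "to_calkin (S - T) = to_calkin S - to_calkin T"
  and to_calkin_uminus: "to_calkin (- S) = - to_calkin S"
  and to_calkin_scaleC: "to_calkin (c *\<^sub>C S) = c *\<^sub>C to_calkin S"
  and to_calkin_zero: "to_calkin 0 = 0"
  and to_calkin_one: "to_calkin 1 = 1"
  by (simp_all add: times_calkin.abs_eq plus_calkin.abs_eq minus_calkin.abs_eq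
      uminus_calkin.abs_eq scaleC_calkin.abs_eq zero_calkin.abs_eq one_calkin.abs_eq)

lemma to_calkin_sum: "to_calkin (sum f A) = (\<Sum>i\<in>A. to_calkin (f i))"
  by (induction A rule: infinite_finite_induct) (simp_all add: to_calkin_zero to_calkin_add)

lemma subalgebra_to_calkin_image: "subalgebra S \<Longrightarrow> subalgebra (to_calkin ` S)"
  unfolding subalgebra_def ball_simps
  by (metis (mono_tags, lifting) image_eqI to_calkin_zero to_calkin_add to_calkin_scaleC to_calkin_mult)

lemma subalgebra_BD: "subalgebra (BD N)"
  unfolding BD_def by (rule subalgebra_to_calkin_image[OF subalgebra_BDT])

lemma subalgebra_BD_poly: "subalgebra (BD_poly N)"
  unfolding BD_poly_def by (rule subalgebra_to_calkin_image[OF subalgebra_BDT_poly])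

lemma BD_poly_subset_BD: "BD_poly N \<subseteq> BD N"
  using BDT_poly_subset_BDT by (auto simp: BD_poly_def BD_def)

lemma to_calkin_in_BD_poly: "T \<in> BDT_poly N \<Longrightarrow> to_calkin T \<in> BD_poly N"
  by (simp add: BD_poly_def)


section \<open>The shift and periodic diagonal operators\<close>

lemma coord_adj_shift: "coord (app (adj shift) x) k = coord x (Suc k)"
  by (metis app_shift_basis_vec cinner_adj_right cinner_basis_right cinner_commute)

lemma adj_shift_shift: "adj shift * shift = 1"
  by (rule bop_eqI, rule ell2_eqI) (simp add: coord_adj_shift coord_shift)

lemma app_adj_shift_basis_vec_0: "app (adj shift) (basis_vec 0) = 0"
  by (rule ell2_eqI) (simp add: coord_adj_shift basis_vec.rep_eq)

lemma app_adj_shift_app_shift: "app (adj shift) (app shift x) = x"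
  using adj_shift_shift by (metis app_one app_times)

lemma app_adj_shift_basis_vec_Suc: "app (adj shift) (basis_vec (Suc k)) = basis_vec k"
  by (metis app_adj_shift_app_shift app_shift_basis_vec)

text \<open>The defect \<open>1 - shift * adj shift\<close> is the rank-one projection onto the
  first basis vector: it maps the unit ball into the image of a compact disc of scalars.\<close>

lemma to_calkin_shift_adj_shift: "to_calkin shift * to_calkin (adj shift) = 1"
proof -
  have "compact_op (1 - shift * adj shift)"
  proof (rule compact_opI)
    have "bounded_linear (\<lambda>c. c *\<^sub>C basis_vec 0)"
      by (rule bounded_linear_intro[where K = 1])
        (simp_all add: scaleC_add_left scaleR_ell2_def scaleC_scaleC scaleR_conv_of_real)
    then show "compact ((\<lambda>c. c *\<^sub>C basis_vec 0) ` cball 0 1)"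
      by (intro compact_continuous_image linear_continuous_on compact_cball)
    show "app (1 - shift * adj shift) ` cball 0 1 \<subseteq> (\<lambda>c. c *\<^sub>C basis_vec 0) ` cball 0 1"
    proof (rule image_subsetI)
      fix x :: ell2
      assume x: "x \<in> cball 0 1"
      have "app (1 - shift * adj shift) x = coord x 0 *\<^sub>C basis_vec 0"
        by (rule ell2_eqI)
          (simp add: coord_shift coord_adj_shift basis_vec.rep_eq split: nat.split)
      moreover have "norm (coord x 0) \<le> 1"
        using norm_cinner_le[of x "basis_vec 0"] x by (simp add: cinner_basis_right)
      ultimately show "app (1 - shift * adj shift) x \<in> (\<lambda>c. c *\<^sub>C basis_vec 0) ` cball 0 1"
        by auto
    qed
  qed
  then have "to_calkin 1 = to_calkin (shift * adj shift)"
    by (simp add: to_calkin_eq_iff)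
  then show ?thesis
    by (simp add: to_calkin_mult to_calkin_one)
qed

section \<open>Periodic sequences and residue classes modulo N\<close>

lemma periodic_mod:
  assumes "periodic N a"
  shows "a (k mod N) = a k"
proof -
  have "a (i + m * N) = a i" for i m
  proof (induction m)
    case (Suc m)
    have "i + Suc m * N = (i + m * N) + N"
      by simp
    then show ?case
      using assms Suc by (simp only: periodic_def)
  qed simp
  then show ?thesis
    by (metis add.commute div_mult_mod_eq)
qed

lemma periodic_dvd: "periodic j a \<Longrightarrow> j dvd N \<Longrightarrow> periodic N a"
  unfolding periodic_def by (metis dvd_def mod_mult_self2 periodic_def periodic_mod)

lemma bounded_periodic:
  assumes "periodic N a" "N \<ge> 1"
  shows "bounded (range a)"
proof -
  have "a k \<in> a ` {..<N}" for k
    using assms by (intro image_eqI[where x = "k mod N"]) (simp_all add: periodic_mod)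
  then have "range a \<subseteq> a ` {..<N}"
    by blast
  then show ?thesis
    using finite_imp_bounded finite_subset by blast
qed

text \<open>A period dividing \<open>N\<close> can be replaced by \<open>N\<close> itself, and an
  \<open>N\<close>-periodic sequence takes finitely many values, hence is bounded.\<close>

lemma diag_per_eq:
  assumes "N \<ge> 1"
  shows "diag_per N = {diag_op a |a. periodic N a}"
proof -
  have "bounded (range a) \<and> (\<exists>j. j dvd N \<and> periodic j a) \<longleftrightarrow> periodic N a" for a
    by (metis assms bounded_periodic periodic_dvd dvd_refl)
  then show ?thesis
    by (simp add: diag_per_def)
qed

lemma diag_op_in_BDT_poly: "N \<ge> 1 \<Longrightarrow> periodic N a \<Longrightarrow> diag_op a \<in> BDT_poly N"
  using diag_per_subset_BDT_poly diag_per_eq by blast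

lemma diag_op_one: "diag_op (\<lambda>_. 1) = 1"
  by (rule bop_eqI, rule ell2_eqI) (simp add: coord_diag_op)

lemma diag_op_shift:
  assumes "bounded (range a)"
  shows "diag_op a * shift = shift * diag_op (\<lambda>k. a (Suc k))"
proof -
  have "bounded (range (\<lambda>k. a (Suc k)))"
    by (rule bounded_subset[OF assms]) auto
  then show ?thesis
    using assms
    by (intro bop_eqI ell2_eqI) (simp add: coord_diag_op coord_shift split: nat.split)
qed

lemma adj_shift_diag_op:
  assumes "bounded (range a)"
  shows "adj shift * diag_op a = diag_op (\<lambda>k. a (Suc k)) * adj shift"
proof -
  have "bounded (range (\<lambda>k. a (Suc k)))"
    by (rule bounded_subset[OF assms]) auto
  then show ?thesis
    using assms by (intro bop_eqI ell2_eqI) (simp add: coord_diag_op coord_adj_shift)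
qed

text \<open>For \<open>i < N\<close> these orthogonal projections sum to 1 and span the
  \<open>N\<close>-periodic diagonal operators, so claims about all such operators reduce to
  finitely many idempotents.\<close>

definition res_proj :: "nat \<Rightarrow> nat \<Rightarrow> bop" where
  "res_proj N i = diag_op (\<lambda>k. if k mod N = i then 1 else 0)"

lemma coord_res_proj: "coord (app (res_proj N i) x) k = (if k mod N = i then coord x k else 0)"
proof -
  have "finite (range (\<lambda>k. if k mod N = i then 1 else 0 :: complex))"
    by (rule finite_subset[of _ "{0, 1}"]) auto
  then show ?thesis
    unfolding res_proj_def by (subst coord_diag_op) (auto intro: finite_imp_bounded)
qed

lemma periodic_res_proj: "periodic N (\<lambda>k. if k mod N = i then 1 else 0)"
  by (simp add: periodic_def)

lemma res_proj_in_BDT_poly: "N \<ge> 1 \<Longrightarrow> res_proj N i \<in> BDT_poly N"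
  unfolding res_proj_def by (intro diag_op_in_BDT_poly periodic_res_proj)

lemma res_proj_mult: "res_proj N i * res_proj N j = (if i = j then res_proj N i else 0)"
  by (rule bop_eqI, rule ell2_eqI) (auto simp: coord_res_proj)

lemma app_sum_left: "app (\<Sum>i\<in>I. f i) x = (\<Sum>i\<in>I. app (f i) x)"
  by (induction I rule: infinite_finite_induct) simp_all

lemma diag_op_eq_sum_res_proj:
  assumes "N \<ge> 1" "periodic N a"
  shows "diag_op a = (\<Sum>i<N. a i *\<^sub>C res_proj N i)"
proof (rule bop_eqI, rule ell2_eqI)
  fix x k
  have "coord (app (\<Sum>i<N. a i *\<^sub>C res_proj N i) x) k =
      (\<Sum>i<N. if k mod N = i then a i * coord x k else 0)"
    unfolding app_sum_left coord_sum
    by (rule sum.cong) (simp_all add: app_scaleC_bop coord_res_proj)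
  also have "\<dots> = a k * coord x k"
    using assms by (subst sum.delta') (simp_all add: periodic_mod)
  finally show "coord (app (diag_op a) x) k = coord (app (\<Sum>i<N. a i *\<^sub>C res_proj N i) x) k"
    using assms by (simp add: coord_diag_op bounded_periodic)
qed

lemma sum_res_proj: "N \<ge> 1 \<Longrightarrow> (\<Sum>i<N. res_proj N i) = 1"
  using diag_op_eq_sum_res_proj[of N "\<lambda>_. 1"]
  by (simp add: diag_op_one periodic_def scaleC_one)


section \<open>Lifting derivations\<close>

text \<open>An arbitrary lift commutes with the diagonals only up to compact operators. Its
  block-diagonal part with respect to the residue projections commutes with them exactly, and has
  the same class because \<open>f\<close> already commutes with the projections.\<close>

lemma lift_commuting_with_diagonals:
  assumes N: "N \<ge> 1" and f: "f \<in> BD N"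
    and comm: "\<And>a. periodic N a \<Longrightarrow> to_calkin (diag_op a) * f = f * to_calkin (diag_op a)"
  obtains F where "F \<in> BDT N" "to_calkin F = f"
    "\<And>a. periodic N a \<Longrightarrow> diag_op a * F = F * diag_op a"
proof -
  let ?p = "res_proj N"
  have p: "?p i \<in> BDT N" for i
    using res_proj_in_BDT_poly[OF N] BDT_poly_subset_BDT by blast
  obtain F0 where F0: "F0 \<in> BDT N" "f = to_calkin F0"
    using f by (auto simp: BD_def)
  define F where "F = (\<Sum>i<N. ?p i * F0 * ?p i)"
  have "F \<in> BDT N"
    unfolding F_def by (intro subalgebra_sum subalgebra_mult subalgebra_BDT p F0)
  moreover have "to_calkin F = f"
  proof -
    have pf: "to_calkin (?p i) * f = f * to_calkin (?p i)" for i
      unfolding res_proj_def by (rule comm[OF periodic_res_proj])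
    have "to_calkin F = (\<Sum>i<N. f * to_calkin (?p i * ?p i))"
      by (simp add: F_def to_calkin_sum to_calkin_mult F0(2)[symmetric] pf)
        (simp add: mult.assoc)
    also have "\<dots> = f * to_calkin (\<Sum>i<N. ?p i)"
      by (simp add: res_proj_mult to_calkin_sum sum_distrib_left)
    finally show ?thesis
      by (simp add: sum_res_proj[OF N] to_calkin_one)
  qed
  moreover have "diag_op a * F = F * diag_op a" if a: "periodic N a" for a
  proof -
    have pF: "?p j * F = F * ?p j" if "j < N" for j
    proof -
      have "?p j * F = (\<Sum>i<N. (?p j * ?p i) * F0 * ?p i)"
        by (simp add: F_def sum_distrib_left mult.assoc)
      \<comment> \<open>In both sums only \<open>i = j\<close> survives, with the term
        \<open>?p j * F0 * ?p j\<close>.\<close>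
      also have "\<dots> = (\<Sum>i<N. ?p i * F0 * (?p i * ?p j))"
        by (rule sum.cong) (auto simp: res_proj_mult)
      finally show ?thesis
        by (simp add: F_def sum_distrib_right mult.assoc)
    qed
    show ?thesis
      unfolding diag_op_eq_sum_res_proj[OF N a]
      by (simp add: sum_distrib_left sum_distrib_right mult_scaleC_left mult_scaleC_right pF)
  qed
  ultimately show ?thesis
    using that by blast
qed

text \<open>The vectors H E_k of the unbounded operator H. The recursion is H U = U H + U F
  evaluated at E_k; the start H E_0 = 0 is a choice that also fits the relations for the adjoint
  shift and the diagonals.\<close>

primrec shift_potential :: "bop \<Rightarrow> nat \<Rightarrow> ell2" where
  "shift_potential F 0 = 0"
| "shift_potential F (Suc k) = app shift (shift_potential F k + app F (basis_vec k))"

lemma fin_commutator_shift: "fin_commutator (shift_potential F) shift (shift * F)"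
  by (rule fin_commutatorI)
    (simp_all add: app_shift_basis_vec fin_supp_basis_vec fin_ext_basis_vec app_add_right)

text \<open>At E_{k+1} the recursion gives H E_k - (H E_k + F E_k) = - F E_k. At E_0 everything
  vanishes, because H E_0 = 0 and the adjoint shift kills E_0; hence no finite-rank correction
  appears.\<close>

lemma fin_commutator_adj_shift: "fin_commutator (shift_potential F) (adj shift) (- (F * adj shift))"
proof (rule fin_commutatorI)
  have neg: "app (- T) x = - app T x" for T x
    using app_minus[of 0 T x] by simp
  fix k
  show "app (adj shift) (basis_vec k) \<in> fin_supp"
    by (cases k) (simp_all add: app_adj_shift_basis_vec_0 app_adj_shift_basis_vec_Suc
        fin_supp_zero fin_supp_basis_vec)
  show "app (- (F * adj shift)) (basis_vec k) =
      fin_ext (shift_potential F) (app (adj shift) (basis_vec k)) -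
      app (adj shift) (shift_potential F k)"
    by (cases k) (simp_all add: neg app_adj_shift_basis_vec_0 app_adj_shift_basis_vec_Suc
        app_adj_shift_app_shift fin_ext_zero fin_ext_basis_vec)
qed

lemma fin_commutator_diag_op:
  assumes N: "N \<ge> 1" and F: "\<And>a. periodic N a \<Longrightarrow> diag_op a * F = F * diag_op a"
    and a: "periodic N a"
  shows "fin_commutator (shift_potential F) (diag_op a) 0"
proof (rule fin_commutatorI)
  \<comment> \<open>H E_k is in the eigenspace of every periodic diagonal operator that contains
    E_k. The induction keeps \<open>a\<close> arbitrary, since moving past the shift replaces
    \<open>a\<close> by its translate \<open>?s\<close>.\<close>
  have ev: "app (diag_op a) (shift_potential F k) = a k *\<^sub>C shift_potential F k"
    if "periodic N a" for a k
    using that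
  proof (induction k arbitrary: a)
    case (Suc k)
    let ?s = "\<lambda>k. a (Suc k)"
    have s: "periodic N ?s"
      using Suc.prems unfolding periodic_def by (metis add_Suc)
    have ba: "bounded (range a)" "bounded (range ?s)"
      using Suc.prems s N by (blast intro: bounded_periodic)+
    have "app (diag_op ?s) (app F (basis_vec k)) = app F (app (diag_op ?s) (basis_vec k))"
      using F[OF s] by (metis app_times)
    then have Fk: "app (diag_op ?s) (app F (basis_vec k)) = ?s k *\<^sub>C app F (basis_vec k)"
      by (simp add: app_diag_op_basis_vec ba app_scaleC)
    have "app (diag_op a) (app shift y) = app shift (app (diag_op ?s) y)" for y
      using diag_op_shift[OF ba(1)] by (metis app_times)
    then show ?case
      by (simp add: app_add_right Suc.IH[OF s] Fk app_scaleC scaleC_add_right)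
  qed simp
  fix k
  have k: "app (diag_op a) (basis_vec k) = a k *\<^sub>C basis_vec k"
    using app_diag_op_basis_vec bounded_periodic[OF a N] by blast
  then show "app (diag_op a) (basis_vec k) \<in> fin_supp"
    by (simp add: fin_supp_scaleC fin_supp_basis_vec)
  show "app 0 (basis_vec k) = fin_ext (shift_potential F) (app (diag_op a) (basis_vec k)) -
      app (diag_op a) (shift_potential F k)"
    by (simp add: k ev[OF a] fin_ext_scaleC fin_supp_basis_vec fin_ext_basis_vec)
qed

text \<open>The lift is the commutator with H. It is determined by its values on the generators, so
  bounded commutators in \<open>BDT N\<close> that represent \<delta> need only be found
  there.\<close>

lemma derivation_lifts_if_zero_on_diagonals:
  assumes N: "N \<ge> 1" and \<delta>: "derivation (BD_poly N) (BD N) \<delta>"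
    and zero: "\<And>a. periodic N a \<Longrightarrow> \<delta> (to_calkin (diag_op a)) = 0"
  shows "\<exists>d. derivation (BDT_poly N) (BDT N) d \<and>
           (\<forall>a\<in>BDT_poly N. \<delta> (to_calkin a) = to_calkin (d a))"
proof -
  define u where "u = to_calkin shift"
  define v where "v = to_calkin (adj shift)"
  \<comment> \<open>Since \<open>v\<close> is the inverse of \<open>u\<close> in the quotient,
    \<open>f\<close> is the logarithmic derivative of \<open>u\<close>.\<close>
  define f where "f = v * \<delta> u"
  have u: "u \<in> BD_poly N" and v: "v \<in> BD_poly N"
    by (simp_all add: u_def v_def to_calkin_in_BD_poly shift_in_BDT_poly adj_shift_in_BDT_poly)
  have uv: "u * v = 1" and vu: "v * u = 1"
    unfolding u_def v_def
    by (fact to_calkin_shift_adj_shift)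
      (simp add: to_calkin_mult[symmetric] adj_shift_shift to_calkin_one)
  have "\<delta> 1 = 0"
    using zero[of "\<lambda>_. 1"] by (simp add: diag_op_one to_calkin_one periodic_def)
  then have "\<delta> v * u + f = 0"
    using derivation_mult[OF \<delta> v u] by (simp add: vu f_def)
  then have "\<delta> v * u = - f"
    by (simp add: eq_neg_iff_add_eq_0)
  then have dv: "\<delta> v = - (f * v)"
    by (metis mult.assoc mult.right_neutral uv mult_minus_left)
  have du: "\<delta> u = u * f"
    by (simp add: f_def mult.assoc[symmetric] uv)
  have "f \<in> BD N"
    unfolding f_def using v BD_poly_subset_BD
    by (blast intro: subalgebra_mult[OF subalgebra_BD] derivation_in[OF \<delta> u])
  moreover have "to_calkin (diag_op c) * f = f * to_calkin (diag_op c)" if c: "periodic N c" for c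
  proof -
    \<comment> \<open>The sequence \<open>c\<close> moved by one step against the shift; adding
      \<open>N - 1\<close> instead of subtracting 1 keeps the index natural.\<close>
    define a where "a k = c (k + (N - 1))" for k
    have "periodic N a"
      using c by (simp add: periodic_def a_def add.assoc) (metis add.assoc add.commute)
    have ca: "c = (\<lambda>k. a (Suc k))"
      using c N by (auto simp: periodic_def a_def)
    have ba: "bounded (range a)"
      using \<open>periodic N a\<close> N by (rule bounded_periodic)
    let ?a = "to_calkin (diag_op a)" and ?c = "to_calkin (diag_op c)"
    have a: "?a \<in> BD_poly N" and c': "?c \<in> BD_poly N"
      using c \<open>periodic N a\<close> N by (simp_all add: to_calkin_in_BD_poly diag_op_in_BDT_poly)
    have au: "?a * u = u * ?c" and va: "v * ?a = ?c * v"
      using diag_op_shift[OF ba] adj_shift_diag_op[OF ba]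
      by (simp_all add: u_def v_def to_calkin_mult[symmetric] ca)
    \<comment> \<open>Apply \<delta>, which kills diagonals, to both sides of
      \<open>?a * u = u * ?c\<close>; multiplying the result by \<open>v\<close> on the left gives
      the commutation of \<open>f\<close> with \<open>?c\<close>.\<close>
    have "\<delta> (?a * u) = ?a * \<delta> u" "\<delta> (u * ?c) = \<delta> u * ?c"
      using derivation_mult[OF \<delta> a u] derivation_mult[OF \<delta> u c']
        zero[OF c] zero[OF \<open>periodic N a\<close>] by simp_all
    then have "?a * \<delta> u = \<delta> u * ?c"
      by (simp add: au)
    then show ?thesis
      unfolding f_def by (metis mult.assoc va)
  qed
  ultimately obtain F where F: "F \<in> BDT N" "to_calkin F = f"
    "\<And>a. periodic N a \<Longrightarrow> diag_op a * F = F * diag_op a"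
    using lift_commuting_with_diagonals[OF N] by metis
  \<comment> \<open>All requirements on a value \<open>R\<close> of the lift at \<open>T\<close> are
    bundled, so that the operators admitting such a value form a subalgebra.\<close>
  define Q where "Q T R \<longleftrightarrow> T \<in> BDT_poly N \<and> R \<in> BDT N \<and> fin_commutator (shift_potential F) T R \<and>
    \<delta> (to_calkin T) = to_calkin R" for T R
  note sub = subalgebra_BDT_poly[of N] subalgebra_BDT[of N]
  have poly: "T \<in> BDT N" if "T \<in> BDT_poly N" for T
    using that BDT_poly_subset_BDT by blast
  have Q_zero: "Q 0 0"
    using sub derivation_zero[OF \<delta> subalgebra_zero[OF subalgebra_BD_poly]]
    by (simp add: Q_def subalgebra_zero fin_commutator_zero to_calkin_zero)
  have Q_add: "Q (S + T) (X + Y)" if "Q S X" "Q T Y" for S T X Y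
    using that sub derivation_add[OF \<delta>]
    by (simp add: Q_def subalgebra_add fin_commutator_add to_calkin_add to_calkin_in_BD_poly)
  have Q_scaleC: "Q (c *\<^sub>C T) (c *\<^sub>C Y)" if "Q T Y" for c T Y
    using that sub derivation_scaleC[OF \<delta>]
    by (simp add: Q_def subalgebra_scaleC fin_commutator_scaleC to_calkin_scaleC to_calkin_in_BD_poly)
  have Q_mult: "Q (S * T) (X * T + S * Y)" if "Q S X" "Q T Y" for S T X Y
    using that sub derivation_mult[OF \<delta>] poly
    by (simp add: Q_def subalgebra_add subalgebra_mult fin_commutator_mult to_calkin_add
        to_calkin_mult to_calkin_in_BD_poly)
  have "BDT_poly N \<subseteq> {T. \<exists>R. Q T R}"
    unfolding BDT_poly_def
  proof (rule hull_minimal)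
    show "subalgebra {T. \<exists>R. Q T R}"
      unfolding subalgebra_def using Q_zero Q_add Q_scaleC Q_mult by blast
    have "Q shift (shift * F)"
      using du by (simp add: Q_def shift_in_BDT_poly poly F fin_commutator_shift to_calkin_mult
          subalgebra_mult[OF sub(2)] u_def)
    moreover have "Q (adj shift) (- (F * adj shift))"
      using dv by (simp add: Q_def adj_shift_in_BDT_poly poly F fin_commutator_adj_shift
          to_calkin_mult to_calkin_uminus subalgebra_mult[OF sub(2)] subalgebra_uminus[OF sub(2)] v_def)
    moreover have "Q (diag_op a) 0" if "periodic N a" for a
      using that fin_commutator_diag_op[OF N F(3)]
      by (simp add: Q_def diag_op_in_BDT_poly[OF N] subalgebra_zero[OF sub(2)] zero to_calkin_zero)
    ultimately show "{shift, adj shift} \<union> diag_per N \<subseteq> {T. \<exists>R. Q T R}"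
      unfolding diag_per_eq[OF N] by blast
  qed
  then have "\<forall>T\<in>BDT_poly N. \<exists>R. Q T R"
    by blast
  from bchoice[OF this] obtain d where d: "\<And>T. T \<in> BDT_poly N \<Longrightarrow> Q T (d T)"
    by blast
  \<comment> \<open>The choice of \<open>d\<close> is forced by uniqueness of the commutator, so any
    value built by the closure rules of \<open>Q\<close> is the chosen one.\<close>
  have d_eq: "d T = R" if "Q T R" for T R
    using that d fin_commutator_unique unfolding Q_def by blast
  have "derivation (BDT_poly N) (BDT N) d"
    unfolding derivation_def
  proof (intro conjI ballI allI)
    fix S T c assume S: "S \<in> BDT_poly N" and T: "T \<in> BDT_poly N"
    show "d S \<in> BDT N"
      using d[OF S] by (simp add: Q_def)
    show "d (S + T) = d S + d T" "d (c *\<^sub>C S) = c *\<^sub>C d S" "d (S * T) = d S * T + S * d T"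
      using d[OF S] d[OF T] by (intro d_eq Q_add Q_scaleC Q_mult; simp)+
  qed
  then show ?thesis
    using d unfolding Q_def by blast
qed

section \<open>Reduction to derivations vanishing on the periodic diagonals\<close>

theorem mainTheorem5:
  fixes N :: nat and \<delta> :: "calkin \<Rightarrow> calkin"
  assumes "N \<ge> 1"
    and "derivation (BD_poly N) (BD N) \<delta>"
  shows "\<exists>d :: bop \<Rightarrow> bop. derivation (BDT_poly N) (BDT N) d \<and>
           (\<forall>a\<in>BDT_poly N. \<delta> (to_calkin a) = to_calkin (d a))"
proof -
  note N = assms(1) and \<delta> = assms(2)
  let ?p = "\<lambda>i. to_calkin (res_proj N i)"
  have p: "?p i \<in> BD_poly N" for i
    by (intro to_calkin_in_BD_poly res_proj_in_BDT_poly N)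
  define b where "b = (\<Sum>i<N. \<delta> (?p i) * ?p i)"
  have b_in: "b \<in> BD N"
    unfolding b_def using p BD_poly_subset_BD
    by (blast intro: subalgebra_sum[OF subalgebra_BD] subalgebra_mult[OF subalgebra_BD]
        derivation_in[OF \<delta>])
  then obtain B where B: "B \<in> BDT N" "b = to_calkin B"
    by (auto simp: BD_def)
  \<comment> \<open>This is \<delta> minus the commutator with \<open>b\<close>, written with
    \<open>- b\<close> to match \<open>derivation_add_commutator\<close>.\<close>
  define \<epsilon> where "\<epsilon> x = \<delta> x + (- b * x - x * - b)" for x
  have \<epsilon>: "derivation (BD_poly N) (BD N) \<epsilon>"
    unfolding \<epsilon>_def
    by (intro derivation_add_commutator \<delta> subalgebra_BD BD_poly_subset_BD subalgebra_uminus b_in)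
  have "\<delta> (?p j) = b * ?p j - ?p j * b" if "j < N" for j
    unfolding b_def
    by (rule derivation_inner_on_idempotents[OF \<delta> subalgebra_BD_poly])
      (use that in \<open>auto simp: p to_calkin_mult[symmetric] res_proj_mult to_calkin_zero
        to_calkin_sum[symmetric] sum_res_proj[OF N] to_calkin_one\<close>)
  then have \<epsilon>p: "\<epsilon> (?p j) = 0" if "j < N" for j
    using that by (simp add: \<epsilon>_def)
  have "\<epsilon> (to_calkin (diag_op a)) = 0" if a: "periodic N a" for a
    unfolding diag_op_eq_sum_res_proj[OF N a] to_calkin_sum to_calkin_scaleC
    by (subst derivation_sum[OF \<epsilon> subalgebra_BD_poly])
      (simp_all add: subalgebra_scaleC[OF subalgebra_BD_poly] p derivation_scaleC[OF \<epsilon>] \<epsilon>p)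
  then obtain d where d: "derivation (BDT_poly N) (BDT N) d"
    and eq: "\<And>T. T \<in> BDT_poly N \<Longrightarrow> \<epsilon> (to_calkin T) = to_calkin (d T)"
    using derivation_lifts_if_zero_on_diagonals[OF N \<epsilon>] by blast
  show ?thesis
  proof (intro exI conjI ballI)
    \<comment> \<open>The commutator with \<open>B\<close> lifts the commutator with
      \<open>b\<close>, which restores the inner part removed in \<epsilon>.\<close>
    show "derivation (BDT_poly N) (BDT N) (\<lambda>T. d T + (B * T - T * B))"
      by (rule derivation_add_commutator[OF d subalgebra_BDT BDT_poly_subset_BDT B(1)])
    show "\<delta> (to_calkin T) = to_calkin (d T + (B * T - T * B))" if "T \<in> BDT_poly N" for T
      using eq[OF that]
      by (simp add: \<epsilon>_def to_calkin_add to_calkin_diff to_calkin_mult B(2)[symmetric] algebra_simps)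
  qed
qed

end
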